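(* Let $G$ be a finite simple graph, let $e$ be an edge of $G$, and let $G_e$ be a graph obtained from $G$ by subdividing $e$ at least once (i.e. by replacing $e$ with a path of any length at least $2$). Then $G_e$ is semi-transitively orientable if and only if $G\setminus e$ is semi-transitively orientable.
   Context: Graphs are finite, undirected and simple. An orientation of a graph assigns to each edge one of its two directions; it is acyclic if it has no directed cycle. A digraph is transitive if whenever $v_1\to v_2$ and $v_2\to v_3$ are directed edges on three distinct vertices, $v_1\to v_3$ is also a directed edge. Given an acyclic orientation $\phi$ of a graph $G$, a shortcut in $\phi(G)$ is a non-transitive induced subdigraph of $\phi(G)$ on a vertex set $\{v_1,\dots,v_n\}$ with $n\ge 4$ (distinct vertices) that contains the directed path $v_1\to v_2\to\cdots\to v_n$ and the directed edge $v_1\to v_n$. An acyclic orientation $\phi$ is semi-transitive if $\phi(G)$ contains no shortcut, and a graph is semi-transitively orientable if it has a semi-transitive orientation. $G\setminus e$ denotes $G$ with the edge $e$ deleted (keeping all vertices). Subdividing $e=xy$ at least once means deleting $e$ and adding a path $x,p_1,\dots,p_t,y$ with $t\ge 1$, where $p_1,\dots,p_t$ are new vertices. *)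

theory Defs
  imports "Graph_Theory.Graph_Theory"
begin

text \<open>
  A finite simple graph is a \<^locale>\<open>pair_graph\<close>: a finite loop-free symmetric digraph whose arcs
  are pairs of vertices, so that an edge with ends x and y is the pair of arcs (x,y), (y,x).
\<close>

definition orientation_of :: "'a pair_pre_digraph \<Rightarrow> 'a pair_pre_digraph \<Rightarrow> bool" where
  "orientation_of G D \<longleftrightarrow>
     pverts D = pverts G \<and> parcs D \<subseteq> parcs G \<and>
     (\<forall>(u, v) \<in> parcs G. ((u, v) \<in> parcs D) \<noteq> ((v, u) \<in> parcs D))"

definition acyclic_digraph :: "('a, 'b) pre_digraph \<Rightarrow> bool" where
  "acyclic_digraph D \<longleftrightarrow> \<not> (\<exists>p. pre_digraph.cycle D p)"

definition transitive_digraph :: "('a, 'b) pre_digraph \<Rightarrow> bool" where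
  "transitive_digraph D \<longleftrightarrow>
     (\<forall>v1 v2 v3. distinct [v1, v2, v3] \<and> (v1, v2) \<in> arcs_ends D \<and> (v2, v3) \<in> arcs_ends D
        \<longrightarrow> (v1, v3) \<in> arcs_ends D)"

definition shortcut :: "('a, 'b) pre_digraph \<Rightarrow> ('a, 'b) pre_digraph \<Rightarrow> bool" where
  "shortcut D S \<longleftrightarrow>
     induced_subgraph S D \<and> \<not> transitive_digraph S \<and>
     (\<exists>vs. 4 \<le> length vs \<and> verts S = set vs \<and> vpath vs S \<and> (hd vs, last vs) \<in> arcs_ends S)"

definition semi_transitive_orientation :: "'a pair_pre_digraph \<Rightarrow> 'a pair_pre_digraph \<Rightarrow> bool" where
  "semi_transitive_orientation G D \<longleftrightarrow>
     orientation_of G D \<and> acyclic_digraph (with_proj D) \<and> \<not> (\<exists>S. shortcut (with_proj D) S)"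

definition semi_transitively_orientable :: "'a pair_pre_digraph \<Rightarrow> bool" where
  "semi_transitively_orientable G \<longleftrightarrow> (\<exists>D. semi_transitive_orientation G D)"

definition delete_edge :: "'a pair_pre_digraph \<Rightarrow> 'a \<Rightarrow> 'a \<Rightarrow> 'a pair_pre_digraph" where
  "delete_edge G x y = \<lparr> pverts = pverts G, parcs = parcs G - {(x, y), (y, x)} \<rparr>"

text \<open>
  Deletes the edge xy and adds the path x, \<open>ps\<close>, y; meaningful when \<open>ps\<close> lists distinct vertices
  outside G. For a single new vertex this is \<^const>\<open>subdivide\<close>.
\<close>

definition subdivide_edge :: "'a pair_pre_digraph \<Rightarrow> 'a \<Rightarrow> 'a \<Rightarrow> 'a list \<Rightarrow> 'a pair_pre_digraph" where
  "subdivide_edge G x y ps =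
     \<lparr> pverts = pverts G \<union> set ps,
       parcs = parcs (delete_edge G x y) \<union>
         (let P = set (vwalk_arcs (x # ps @ [y])) in P \<union> P\<inverse>) \<rparr>"

lemma subdivide_edge_single: "subdivide_edge G x y [w] = subdivide G (x, y) w"
  by (auto simp: subdivide_edge_def delete_edge_def subdivide.simps Let_def)

end

theory Submission
  imports Defs
begin

text \<open>
  Deleting the inner vertices of the subdividing path from \<open>G\<^sub>e\<close> leaves \<open>G - e\<close> as an induced
  subgraph, and semi-transitive orientability is hereditary. Conversely, the path is attached one
  vertex at a time, so it suffices to attach a vertex w to two vertices a, b that are equal or not
  adjacent. If neither a nor b reaches the other, w is made a sink, which can only be the end of a
  shortcut, and such a shortcut would contain a directed path between a and b. If a reaches b, orient
  \<open>a \<rightarrow> w \<rightarrow> b\<close>; then w is an inner vertex of any shortcut through it. Replacing \<open>a \<rightarrow> w \<rightarrow> b\<close>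
  by an old path from a to b yields a path with an edge from its first to its last vertex, and by
  semi-transitivity a and b are adjacent, a contradiction.
\<close>

abbreviation chain :: "'a rel \<Rightarrow> 'a list \<Rightarrow> bool" where
  "chain R \<equiv> successively (\<lambda>u v. (u, v) \<in> R)"

text \<open>Only arcs matter here: a shortcut is induced, so its path determines it. Plain
  \<open>trans\<close> agrees with transitivity on distinct triples because \<open>R\<close> is
  acyclic.\<close>

definition semi_transitive_rel :: "'a rel \<Rightarrow> bool" where
  "semi_transitive_rel R \<longleftrightarrow> acyclic R \<and>
     (\<forall>vs. 4 \<le> length vs \<and> distinct vs \<and> chain R vs \<and> (hd vs, last vs) \<in> R
        \<longrightarrow> trans (Restr R (set vs)))"

text \<open>For a loop the inequality reads \<open>P \<noteq> P\<close>, so orientability already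
  forces \<open>E\<close> to be loop-free.\<close>

definition orientable_rel :: "'a rel \<Rightarrow> bool" where
  "orientable_rel E \<longleftrightarrow>
     (\<exists>R \<subseteq> E. (\<forall>(u, v) \<in> E. ((u, v) \<in> R) \<noteq> ((v, u) \<in> R)) \<and> semi_transitive_rel R)"

section \<open>Semi-transitivity as a property of relations\<close>

lemma vwalk_arcs_subset_iff_chain: "set (vwalk_arcs vs) \<subseteq> R \<longleftrightarrow> chain R vs"
  by (induction vs rule: vwalk_arcs.induct) auto

lemma vwalk_arcs_subset_Times: "set (vwalk_arcs vs) \<subseteq> set vs \<times> set vs"
  by (induction vs rule: vwalk_arcs.induct) auto

text \<open>Every closed walk contains a cycle, so a cycle exists exactly when some vertex reaches
  itself in at least one step.\<close>

lemma acyclic_digraph_with_proj_iff: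
  assumes "pair_wf_digraph D"
  shows "acyclic_digraph (with_proj D) \<longleftrightarrow> acyclic (parcs D)"
proof -
  interpret pair_wf_digraph D by fact
  have "(\<exists>p. cycle p) \<longleftrightarrow> (\<exists>p. closed_w p)"
    using closed_w_imp_cycle cycle_altdef by blast
  also have "\<dots> \<longleftrightarrow> (\<exists>u. (u, u) \<in> (parcs D)\<^sup>+)"
    unfolding closed_w_def using reachable1_awalk by auto
  finally show ?thesis
    unfolding acyclic_digraph_def acyclic_def by blast
qed

text \<open>A triple with a repeated vertex would yield a loop or a directed 2-cycle.\<close>

lemma trans_iff_distinct_triples:
  assumes "acyclic R"
  shows "trans R \<longleftrightarrow>
    (\<forall>u v w. distinct [u, v, w] \<and> (u, v) \<in> R \<and> (v, w) \<in> R \<longrightarrow> (u, w) \<in> R)"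
proof -
  have loopfree: "u \<noteq> v" if "(u, v) \<in> R" for u v
    using assms that by (auto simp: acyclic_def)
  have no_2_cycle: "u \<noteq> w" if "(u, v) \<in> R" "(v, w) \<in> R" for u v w
    using assms that unfolding acyclic_def by (meson trancl.intros)
  show ?thesis
    by (simp add: trans_def) (metis loopfree no_2_cycle)
qed

lemma shortcut_with_proj_iff:
  assumes "pair_wf_digraph D" and "acyclic (parcs D)"
  shows "(\<exists>S. shortcut (with_proj D) S) \<longleftrightarrow>
    (\<exists>vs. 4 \<le> length vs \<and> distinct vs \<and> chain (parcs D) vs \<and> (hd vs, last vs) \<in> parcs D
       \<and> \<not> trans (Restr (parcs D) (set vs)))" (is "?L \<longleftrightarrow> ?R")
proof
  assume ?L
  then obtain S vs where S: "induced_subgraph S (with_proj D)" "\<not> transitive_digraph S"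
    and vs: "4 \<le> length vs" "verts S = set vs" "vpath vs S" "(hd vs, last vs) \<in> arcs_ends S"
    unfolding shortcut_def by blast
  \<comment> \<open>Being induced, \<open>S\<close> has exactly the arcs of \<open>D\<close> between
    vertices of the path.\<close>
  from S(1) vs(2) have ends: "arcs_ends S = Restr (parcs D) (set vs)"
    by (auto simp: induced_subgraph_def subgraph_def compatible_def arcs_ends_conv)
  have "acyclic (Restr (parcs D) (set vs))"
    using assms(2) by (rule acyclic_subset) auto
  then have "\<not> trans (Restr (parcs D) (set vs))"
    using S(2) by (simp add: trans_iff_distinct_triples transitive_digraph_def ends)
  moreover have "distinct vs" "chain (parcs D) vs"
    using vs(3) by (auto simp: vpath_def vwalk_def ends simp flip: vwalk_arcs_subset_iff_chain)
  ultimately show ?R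
    using vs(1,4) ends by auto
next
  assume ?R
  then obtain vs where vs: "4 \<le> length vs" "distinct vs" "chain (parcs D) vs"
    "(hd vs, last vs) \<in> parcs D" "\<not> trans (Restr (parcs D) (set vs))" by blast
  define S where "S = with_proj \<lparr> pverts = set vs, parcs = Restr (parcs D) (set vs) \<rparr>"
  have [simp]: "verts S = set vs" "arcs S = Restr (parcs D) (set vs)"
    "arcs_ends S = Restr (parcs D) (set vs)" "tail S = fst" "head S = snd"
    by (simp_all add: S_def)
  have ne: "vs \<noteq> []" using vs(1) by auto
  \<comment> \<open>Each vertex but the last is the tail of a path arc; the last is the head of the
    closing arc.\<close>
  have "v \<in> pverts D" if "v \<in> set vs" for v
  proof -
    from that obtain i where i: "i < length vs" "v = vs ! i" by (auto simp: in_set_conv_nth)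
    show ?thesis
    proof (cases "Suc i < length vs")
      case True
      then have "(vs ! i, vs ! Suc i) \<in> parcs D"
        using vs(3) by (simp add: successively_conv_nth)
      then show ?thesis
        using i assms(1) pair_wf_digraph.in_arcsD1 by fast
    next
      case False
      then have "v = last vs" using i ne by (metis Suc_lessI diff_Suc_1 last_conv_nth)
      then show ?thesis
        using vs(4) assms(1) pair_wf_digraph.in_arcsD2 by fast
    qed
  qed
  then have "induced_subgraph S (with_proj D)"
    using assms(1) wf_digraph_wp_iff[of D]
    by (auto simp: induced_subgraph_def subgraph_def compatible_def wf_digraph_def)
  moreover have "acyclic (Restr (parcs D) (set vs))"
    using assms(2) by (rule acyclic_subset) auto
  then have "\<not> transitive_digraph S"
    using vs(5) by (simp add: trans_iff_distinct_triples transitive_digraph_def)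
  moreover have "vpath vs S"
    using vs(2,3) ne vwalk_arcs_subset_Times[of vs]
    by (auto simp: vpath_def vwalk_def simp flip: vwalk_arcs_subset_iff_chain)
  ultimately have "shortcut (with_proj D) S"
    unfolding shortcut_def using vs(1,4) ne by auto
  then show ?L by blast
qed

lemma semi_transitively_orientable_iff:
  assumes "pair_wf_digraph G"
  shows "semi_transitively_orientable G \<longleftrightarrow> orientable_rel (parcs G)"
proof -
  have wf: "pair_wf_digraph D" if "orientation_of G D" for D
    using that assms unfolding orientation_of_def pair_wf_digraph_def by (metis subsetD)
  have "semi_transitive_orientation G D \<longleftrightarrow>
      orientation_of G D \<and> semi_transitive_rel (parcs D)" for D
    unfolding semi_transitive_orientation_def semi_transitive_rel_def
    using wf[of D] acyclic_digraph_with_proj_iff[of D] shortcut_with_proj_iff[of D] by blast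
  moreover have "(\<exists>D. orientation_of G D \<and> semi_transitive_rel (parcs D)) \<longleftrightarrow>
      orientable_rel (parcs G)"
  proof
    assume "\<exists>D. orientation_of G D \<and> semi_transitive_rel (parcs D)"
    then show "orientable_rel (parcs G)"
      unfolding orientation_of_def orientable_rel_def by blast
  next
    assume "orientable_rel (parcs G)"
    then obtain R where R: "R \<subseteq> parcs G" "\<forall>(u, v) \<in> parcs G. ((u, v) \<in> R) \<noteq> ((v, u) \<in> R)"
      "semi_transitive_rel R"
      unfolding orientable_rel_def by blast
    then show "\<exists>D. orientation_of G D \<and> semi_transitive_rel (parcs D)"
      by (intro exI[of _ "\<lparr> pverts = pverts G, parcs = R \<rparr>"]) (simp add: orientation_of_def)
  qed
  ultimately show ?thesis
    unfolding semi_transitively_orientable_def by blast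
qed

text \<open>Heredity: a path with closing arc inside \<open>V\<close> is also one in
  \<open>R\<close>, and restricting a transitive relation keeps it transitive.\<close>

lemma orientable_rel_Restr:
  assumes "orientable_rel E"
  shows "orientable_rel (Restr E V)"
proof -
  from assms obtain R where R: "R \<subseteq> E" "\<forall>(u, v) \<in> E. ((u, v) \<in> R) \<noteq> ((v, u) \<in> R)"
    "acyclic R"
    "\<And>vs. 4 \<le> length vs \<Longrightarrow> distinct vs \<Longrightarrow> chain R vs \<Longrightarrow> (hd vs, last vs) \<in> R
       \<Longrightarrow> trans (Restr R (set vs))"
    unfolding orientable_rel_def semi_transitive_rel_def by blast
  have "trans (Restr (Restr R V) (set vs))"
    if "4 \<le> length vs" "distinct vs" "chain (Restr R V) vs" "(hd vs, last vs) \<in> Restr R V" for vs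
  proof -
    have "chain R vs" using that(3) by (rule successively_mono) auto
    then have "trans (Restr R (set vs))" using R(4) that by blast
    then show ?thesis unfolding trans_def by blast
  qed
  moreover have "acyclic (Restr R V)" using R(3) by (rule acyclic_subset) auto
  ultimately have "semi_transitive_rel (Restr R V)" unfolding semi_transitive_rel_def by blast
  then show ?thesis
    unfolding orientable_rel_def using R(1,2) by (intro exI[of _ "Restr R V"]) auto
qed

section \<open>Attaching a vertex to two non-adjacent vertices\<close>

lemma chain_imp_trancl: "chain R (u # vs) \<Longrightarrow> v \<in> set vs \<Longrightarrow> (u, v) \<in> R\<^sup>+"
  by (induction vs arbitrary: u) (auto intro: trancl_into_trancl2)

text \<open>A repeated vertex would reach itself. This later gives distinctness of a path with a
  detour spliced in.\<close>

lemma chain_imp_distinct: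
  assumes "acyclic R" and "chain R vs"
  shows "distinct vs"
  using assms(2)
proof (induction vs)
  case (Cons v vs)
  then show ?case
    using assms(1) chain_imp_trancl[of R v vs v]
    by (auto simp: acyclic_def successively_Cons)
qed simp

lemma trancl_imp_chain:
  assumes "(u, v) \<in> R\<^sup>+"
  shows "\<exists>vs. chain R (u # vs @ [v])"
  using assms
proof (induction rule: trancl_induct)
  case (base v)
  then show ?case by (intro exI[of _ "[]"]) simp
next
  case (step v w)
  then obtain vs where "chain R (u # vs @ [v])" by blast
  then have "chain R ((u # vs @ [v]) @ [w])"
    using step(2) by (subst successively_append_iff) simp
  then show ?case by (intro exI[of _ "vs @ [v]"]) simp
qed

lemma hd_neq_last: "distinct xs \<Longrightarrow> 2 \<le> length xs \<Longrightarrow> hd xs \<noteq> last xs"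
  by (cases xs) auto

text \<open>No arc of \<open>R\<close> leaves \<open>w\<close>, so the new arc lies on no
  cycle.\<close>

lemma acyclic_insert_fresh:
  assumes "acyclic R" and "w \<notin> Field R" and "a \<noteq> w"
  shows "acyclic (insert (a, w) R)"
proof -
  have "(w, a) \<notin> R\<^sup>*"
    using assms(2,3) by (auto elim: converse_rtranclE intro: FieldI1)
  then show ?thesis using assms(1) by simp
qed

text \<open>The case \<open>a = b\<close> is allowed and makes \<open>w\<close> a pendant vertex;
  both unreachability hypotheses then follow from acyclicity.\<close>

lemma semi_transitive_rel_add_sink:
  assumes R: "semi_transitive_rel R" and w: "w \<notin> Field R" "a \<noteq> w" "b \<noteq> w"
    and unreachable: "(a, b) \<notin> R\<^sup>+" "(b, a) \<notin> R\<^sup>+"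
  shows "semi_transitive_rel (R \<union> {(a, w), (b, w)})"
proof -
  let ?R = "R \<union> {(a, w), (b, w)}"
  have acyc: "acyclic R" using R by (simp add: semi_transitive_rel_def)
  have out: "(w, v) \<notin> ?R" for v using w by (auto intro: FieldI1)
  have "acyclic (insert (b, w) (insert (a, w) R))"
  proof -
    have "(w, b) \<notin> (insert (a, w) R)\<^sup>*"
      using out w(3) by (auto elim: converse_rtranclE)
    then show ?thesis
      using acyclic_insert_fresh[OF acyc w(1,2)] by simp
  qed
  then have "acyclic ?R" by (simp add: insert_commute)
  moreover have "trans (Restr ?R (set vs))"
    if vs: "4 \<le> length vs" "distinct vs" "chain ?R vs" "(hd vs, last vs) \<in> ?R" for vs
  proof (cases "last vs = w")
    case True
    \<comment> \<open>The first vertex (by the closing arc) and the last but one both point to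
      \<open>w\<close>, so both lie in \<open>{a, b}\<close>. They differ because the path has at
      least four vertices.\<close>
    obtain us v where us: "vs = us @ [v, w]" "us \<noteq> []"
    proof -
      obtain us1 where 1: "vs = us1 @ [w]" "us1 \<noteq> []"
        using vs(1) True by (cases vs rule: rev_cases) fastforce+
      then obtain us2 v where 2: "us1 = us2 @ [v]"
        by (cases us1 rule: rev_cases) auto
      then have "us2 \<noteq> []" using vs(1) 1 by auto
      then show ?thesis using that 1 2 by simp
    qed
    have "v \<noteq> w" "w \<notin> set us" "hd us \<noteq> v" using vs(2) us by (cases us; auto)+
    have "(hd us, w) \<in> ?R" "(v, w) \<in> ?R"
      using vs(3,4) us by (auto simp: successively_append_iff)
    then have "hd us \<in> {a, b}" "v \<in> {a, b}" using w(1) by (auto intro: FieldI2)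
    have "chain ?R (us @ [v])" using vs(3) us by (auto simp: successively_append_iff)
    then have "chain R (us @ [v])"
      by (rule successively_mono) (use \<open>v \<noteq> w\<close> \<open>w \<notin> set us\<close> in auto)
    then have "(hd us, v) \<in> R\<^sup>+"
      using us(2) by (cases us) (auto intro: chain_imp_trancl)
    then show ?thesis
      using \<open>hd us \<in> {a, b}\<close> \<open>v \<in> {a, b}\<close> \<open>hd us \<noteq> v\<close> unreachable by auto
  next
    case False
    \<comment> \<open>A sink can occur on a path only as its last vertex.\<close>
    have "w \<notin> set vs"
    proof
      assume "w \<in> set vs"
      then obtain xs ys where "vs = xs @ w # ys" by (meson split_list)
      then show False
        using vs(3) out False by (cases ys) (auto simp: successively_append_iff)
    qed
    then have eq: "Restr ?R (set vs) = Restr R (set vs)" by auto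
    have "chain R vs"
      using vs(3) by (rule successively_mono) (use \<open>w \<notin> set vs\<close> in auto)
    moreover have "(hd vs, last vs) \<in> R" using vs(4) False by auto
    ultimately show ?thesis
      using R vs(1,2) unfolding semi_transitive_rel_def eq by blast
  qed
  ultimately show ?thesis unfolding semi_transitive_rel_def by blast
qed

text \<open>No path with a closing arc and at least four vertices passes through \<open>w\<close>,
  so every vertex list to be tested already belongs to \<open>R\<close>.\<close>

lemma semi_transitive_rel_add_inner:
  assumes R: "semi_transitive_rel R" and w: "w \<notin> Field R" "a \<noteq> w" "b \<noteq> w"
    and ab: "(a, b) \<in> R\<^sup>+" "(a, b) \<notin> R"
  shows "semi_transitive_rel (R \<union> {(a, w), (w, b)})"
proof -
  let ?R = "R \<union> {(a, w), (w, b)}"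
  have acyc: "acyclic R" using R by (simp add: semi_transitive_rel_def)
  have out: "v = b" if "(w, v) \<in> ?R" for v using w that by (auto intro: FieldI1)
  have into: "v = a" if "(v, w) \<in> ?R" for v using w that by (auto intro: FieldI2)
  have "acyclic (insert (w, b) (insert (a, w) R))"
  proof -
    \<comment> \<open>The only way into \<open>w\<close> is from \<open>a\<close>, so
      \<open>b\<close> would reach \<open>a\<close>, which reaches \<open>b\<close>.\<close>
    have "(b, w) \<notin> (insert (a, w) R)\<^sup>*"
    proof
      assume "(b, w) \<in> (insert (a, w) R)\<^sup>*"
      moreover have "(b, w) \<notin> R\<^sup>*"
        using w by (auto elim: rtranclE intro: FieldI2)
      ultimately have "(b, a) \<in> R\<^sup>*" by (auto simp: rtrancl_insert)
      then have "(a, a) \<in> R\<^sup>+" using ab(1) by simp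
      then show False using acyc by (simp add: acyclic_def)
    qed
    then show ?thesis
      using acyclic_insert_fresh[OF acyc w(1,2)] by simp
  qed
  then have "acyclic ?R" by (simp add: insert_commute)
  moreover have "trans (Restr ?R (set vs))"
    if vs: "4 \<le> length vs" "distinct vs" "chain ?R vs" "(hd vs, last vs) \<in> ?R" for vs
  proof (cases "w \<in> set vs")
    case True
    then obtain xs ys where split: "vs = xs @ w # ys" by (meson split_list)
    \<comment> \<open>If \<open>w\<close> came last, its predecessor and the first vertex would both
      be \<open>a\<close>, its only in-neighbour. Dually, \<open>w\<close> cannot come first, as
      \<open>b\<close> is its only out-neighbour.\<close>
    have "ys \<noteq> []"
    proof
      assume "ys = []"
      then have xs: "2 \<le> length xs" "distinct xs" "xs \<noteq> []" using vs(1,2) split by auto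
      then have "(hd xs, w) \<in> ?R" "(last xs, w) \<in> ?R"
        using vs(3,4) split \<open>ys = []\<close> by (simp_all add: successively_append_iff)
      then show False
        using into[of "hd xs"] into[of "last xs"] hd_neq_last[OF xs(2,1)] by simp
    qed
    have "xs \<noteq> []"
    proof
      assume "xs = []"
      then have ys: "2 \<le> length ys" "distinct ys" using vs(1,2) split by auto
      have "(w, hd ys) \<in> ?R" "(w, last ys) \<in> ?R"
        using vs(3,4) split \<open>xs = []\<close> \<open>ys \<noteq> []\<close> by (simp_all add: successively_Cons)
      then show False
        using out[of "hd ys"] out[of "last ys"] hd_neq_last[OF ys(2,1)] by simp
    qed
    have "(last xs, w) \<in> ?R" "(w, hd ys) \<in> ?R"
      using vs(3) split \<open>xs \<noteq> []\<close> \<open>ys \<noteq> []\<close>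
      by (simp_all add: successively_append_iff successively_Cons)
    then have "last xs = a" "hd ys = b" using into out by blast+
    then obtain us zs where uz: "xs = us @ [a]" "ys = b # zs"
      using \<open>xs \<noteq> []\<close> \<open>ys \<noteq> []\<close> by (metis append_butlast_last_id list.collapse)
    obtain ms where ms: "chain R (a # ms @ [b])" using trancl_imp_chain[OF ab(1)] by blast
    have "ms \<noteq> []" using ms ab(2) by auto
    \<comment> \<open>The path \<open>vs\<close> with \<open>w\<close> replaced by the inner
      vertices \<open>ms\<close> of an old path from \<open>a\<close> to \<open>b\<close>.\<close>
    define ws where "ws = us @ (a # ms @ [b]) @ zs"
    have "w \<notin> set us" "w \<notin> set zs" using vs(2) split uz by auto
    have parts: "chain ?R (us @ [a])" "chain ?R (b # zs)"
      using vs(3) split uz by (auto simp: successively_append_iff successively_Cons)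
    have "chain R (us @ [a])"
      using parts(1) by (rule successively_mono) (use \<open>w \<notin> set us\<close> w in auto)
    moreover have "chain R (b # zs)"
      using parts(2) by (rule successively_mono) (use \<open>w \<notin> set zs\<close> w in auto)
    ultimately have "chain R ws"
      using ms \<open>ms \<noteq> []\<close>
      by (auto simp: ws_def successively_append_iff successively_Cons)
    have hl: "hd ws = hd vs" "last ws = last vs"
      using split uz by (auto simp: ws_def hd_append)
    have "hd vs \<noteq> w" "last vs \<noteq> w"
      using split uz \<open>w \<notin> set us\<close> \<open>w \<notin> set zs\<close> w by (auto simp: hd_append)
    then have "(hd ws, last ws) \<in> R" using vs(4) hl by auto
    \<comment> \<open>At least one vertex of \<open>vs\<close> lies outside \<open>a, w, b\<close>;
      together with \<open>a\<close>, \<open>b\<close> and an element of \<open>ms\<close> it makes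
      \<open>ws\<close> long enough.\<close>
    have "us \<noteq> [] \<or> zs \<noteq> []" using vs(1) split uz by auto
    then have "4 \<le> length ws" using \<open>ms \<noteq> []\<close> by (cases us; cases zs; cases ms) (auto simp: ws_def)
    then have tr: "trans (Restr R (set ws))"
      using R \<open>chain R ws\<close> \<open>(hd ws, last ws) \<in> R\<close> chain_imp_distinct[OF acyc]
      unfolding semi_transitive_rel_def by blast
    \<comment> \<open>The detour stays inside \<open>set ws\<close>, where transitivity collapses it
      to the forbidden arc from \<open>a\<close> to \<open>b\<close>.\<close>
    have "chain (Restr R (set ws)) (a # ms @ [b])"
      using ms by (rule successively_mono) (auto simp: ws_def)
    then have "(a, b) \<in> (Restr R (set ws))\<^sup>+" by (rule chain_imp_trancl) simp
    then have "(a, b) \<in> R" using tr by simp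
    then show ?thesis using ab(2) by simp
  next
    case False
    then have eq: "Restr ?R (set vs) = Restr R (set vs)" by auto
    have "chain R vs"
      using vs(3) by (rule successively_mono) (use False in auto)
    moreover have "vs \<noteq> []" using vs(1) by auto
    then have "hd vs \<noteq> w" "last vs \<noteq> w" using False by auto
    then have "(hd vs, last vs) \<in> R" using vs(4) by auto
    ultimately show ?thesis
      using R vs(1,2) unfolding semi_transitive_rel_def eq by blast
  qed
  ultimately show ?thesis unfolding semi_transitive_rel_def by blast
qed

lemma orientable_rel_add_vertex:
  assumes "orientable_rel E" and w: "w \<notin> Field E" "a \<noteq> w" "b \<noteq> w"
    and nonadjacent: "(a, b) \<notin> E" "(b, a) \<notin> E"
  shows "orientable_rel (E \<union> {(a, w), (w, a), (b, w), (w, b)})"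
proof -
  from assms(1) obtain R where R: "R \<subseteq> E" "\<forall>(u, v) \<in> E. ((u, v) \<in> R) \<noteq> ((v, u) \<in> R)"
    "semi_transitive_rel R"
    unfolding orientable_rel_def by blast
  have wR: "w \<notin> Field R" using w(1) R(1) mono_Field by blast
  have nR: "(a, b) \<notin> R" "(b, a) \<notin> R" using nonadjacent R(1) by auto
  have wE: "(v, w) \<notin> E" "(w, v) \<notin> E" for v using w(1) by (auto intro: FieldI1 FieldI2)
  then have wR': "(v, w) \<notin> R" "(w, v) \<notin> R" for v using R(1) by auto
  consider "(a, b) \<notin> R\<^sup>+" "(b, a) \<notin> R\<^sup>+" | "(a, b) \<in> R\<^sup>+" | "(b, a) \<in> R\<^sup>+" by blast
  then show ?thesis
  proof cases
    case 1
    then have "semi_transitive_rel (R \<union> {(a, w), (b, w)})"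
      using semi_transitive_rel_add_sink R(3) wR w by metis
    then show ?thesis
      unfolding orientable_rel_def using R(1,2) wR' wE w
      by (intro exI[of _ "R \<union> {(a, w), (b, w)}"]) auto
  next
    case 2
    \<comment> \<open>For \<open>a = b\<close> the two added arcs would orient one edge both ways;
      that case falls under the sink construction.\<close>
    then have "a \<noteq> b" using R(3) by (auto simp: semi_transitive_rel_def acyclic_def)
    have "semi_transitive_rel (R \<union> {(a, w), (w, b)})"
      using 2 semi_transitive_rel_add_inner R(3) wR w nR by metis
    then show ?thesis
      unfolding orientable_rel_def using R(1,2) wR' wE w \<open>a \<noteq> b\<close>
      by (intro exI[of _ "R \<union> {(a, w), (w, b)}"]) auto
  next
    case 3
    then have "a \<noteq> b" using R(3) by (auto simp: semi_transitive_rel_def acyclic_def)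
    have "semi_transitive_rel (R \<union> {(b, w), (w, a)})"
      using 3 semi_transitive_rel_add_inner R(3) wR w nR by metis
    then show ?thesis
      unfolding orientable_rel_def using R(1,2) wR' wE w \<open>a \<noteq> b\<close>
      by (intro exI[of _ "R \<union> {(b, w), (w, a)}"]) auto
  qed
qed

section \<open>Attaching a path and subdividing an edge\<close>

lemma orientable_rel_add_path:
  assumes "orientable_rel E" and "x \<noteq> y" and "(x, y) \<notin> E" "(y, x) \<notin> E"
    and "ps \<noteq> []" and "distinct ps" and "set ps \<inter> (Field E \<union> {x, y}) = {}"
  shows "orientable_rel (E \<union> (let P = set (vwalk_arcs (x # ps @ [y])) in P \<union> P\<inverse>))"
  using assms(5) assms(1-4,6-)
\<comment> \<open>The first inner vertex is hung on \<open>x\<close> as a pendant vertex and then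
  takes over the role of \<open>x\<close>; the last one is joined to both ends.\<close>
proof (induction ps arbitrary: E x rule: list_nonempty_induct)
  case (single p)
  have "orientable_rel (E \<union> {(x, p), (p, x), (y, p), (p, y)})"
    using single by (intro orientable_rel_add_vertex) auto
  also have "E \<union> {(x, p), (p, x), (y, p), (p, y)} =
      E \<union> (let P = set (vwalk_arcs (x # [p] @ [y])) in P \<union> P\<inverse>)"
    by (auto simp: Let_def)
  finally show ?case .
next
  case (cons p ps)
  \<comment> \<open>The repeated pairs match \<open>orientable_rel_add_vertex\<close> with
    \<open>a = b = x\<close>, where non-adjacency means that \<open>x\<close> has no loop.\<close>
  let ?E = "E \<union> {(x, p), (p, x), (x, p), (p, x)}"
  have "(x, x) \<notin> E" using cons.prems(1) unfolding orientable_rel_def by blast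
  then have "orientable_rel ?E"
    using cons.prems by (intro orientable_rel_add_vertex) auto
  \<comment> \<open>The only neighbour of the new vertex \<open>p\<close> is \<open>x\<close>, which
    differs from \<open>y\<close>.\<close>
  moreover have "(p, y) \<notin> ?E" "(y, p) \<notin> ?E"
    using cons.prems by (auto intro: FieldI1 FieldI2)
  moreover have "set ps \<inter> (Field ?E \<union> {p, y}) = {}"
    using cons.prems by (auto simp: Field_def)
  ultimately have "orientable_rel (?E \<union> (let P = set (vwalk_arcs (p # ps @ [y])) in P \<union> P\<inverse>))"
    using cons.prems by (intro cons.IH) auto
  also have "?E \<union> (let P = set (vwalk_arcs (p # ps @ [y])) in P \<union> P\<inverse>) =
      E \<union> (let P = set (vwalk_arcs (x # (p # ps) @ [y])) in P \<union> P\<inverse>)"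
    by (auto simp: Let_def)
  finally show ?case .
qed

text \<open>Arcs join consecutive entries, and \<open>ps\<close> separates \<open>x\<close> from
  \<open>y\<close>.\<close>

lemma vwalk_arcs_meets_inner:
  assumes "ps \<noteq> []" and "(u, v) \<in> set (vwalk_arcs (x # ps @ [y]))"
  shows "u \<in> set ps \<or> v \<in> set ps"
  using assms
proof (induction ps arbitrary: x rule: list_nonempty_induct)
  case (cons p ps)
  then show ?case by (cases ps) fastforce+
qed auto

theorem theorem1p11:
  fixes G :: "'a pair_pre_digraph" and x y :: 'a and ps :: "'a list"
  assumes "pair_graph G"
    and "(x, y) \<in> parcs G"
    and "ps \<noteq> []" and "distinct ps" and "set ps \<inter> pverts G = {}"
  shows "semi_transitively_orientable (subdivide_edge G x y ps)
     \<longleftrightarrow> semi_transitively_orientable (delete_edge G x y)"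
proof -
  interpret pair_graph G by fact
  let ?P = "set (vwalk_arcs (x # ps @ [y]))"
  let ?E = "parcs (delete_edge G x y)"
  have xy: "x \<in> pverts G" "y \<in> pverts G" "x \<noteq> y"
    using assms(2) wellformed' pair_no_loops by fastforce+
  have E: "?E \<subseteq> pverts G \<times> pverts G"
    using wellformed' by (auto simp: delete_edge_def)
  have P: "?P \<subseteq> (pverts G \<union> set ps) \<times> (pverts G \<union> set ps)"
    using vwalk_arcs_subset_Times[of "x # ps @ [y]"] xy by auto
  have parcs: "parcs (subdivide_edge G x y ps) = ?E \<union> (let P = ?P in P \<union> P\<inverse>)"
    by (simp add: subdivide_edge_def)
  have wf: "pair_wf_digraph (delete_edge G x y)" "pair_wf_digraph (subdivide_edge G x y ps)"
    using E P unfolding pair_wf_digraph_def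
    by (force simp: delete_edge_def, force simp: subdivide_edge_def Let_def delete_edge_def)
  have "orientable_rel ?E" if "orientable_rel (parcs (subdivide_edge G x y ps))"
  proof -
    \<comment> \<open>Every arc of the new path has an end in \<open>ps\<close>, outside
      \<open>pverts G\<close>, so the restriction removes exactly the path.\<close>
    have "Restr (parcs (subdivide_edge G x y ps)) (pverts G) = ?E"
      using E assms(5) vwalk_arcs_meets_inner[OF assms(3), of _ _ x y]
      unfolding parcs Let_def by blast
    then show ?thesis using orientable_rel_Restr[OF that, of "pverts G"] by simp
  qed
  moreover have "orientable_rel (parcs (subdivide_edge G x y ps))" if "orientable_rel ?E"
    unfolding parcs
  proof (rule orientable_rel_add_path[OF that xy(3) _ _ assms(3,4)])
    show "(x, y) \<notin> ?E" "(y, x) \<notin> ?E" by (auto simp: delete_edge_def)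
    show "set ps \<inter> (Field ?E \<union> {x, y}) = {}" using E xy assms(5) by (auto simp: Field_def)
  qed
  ultimately show ?thesis
    using semi_transitively_orientable_iff wf by blast
qed

end
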